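(* For every real number $a$ there exists a real analytic automorphism $f$ of the open interval $(-1,1)$ such that $f'(0) = a$.
   Context: A real analytic automorphism of $(-1,1)$ is a bijection $f:(-1,1)\to(-1,1)$ that is real analytic on $(-1,1)$, i.e. for each point $x_0 \in (-1,1)$, $f$ equals a convergent power series centered at $x_0$ on some neighborhood of $x_0$. The inverse function is not required to be real analytic (for example, $x \mapsto x^3$ counts as a real analytic automorphism of $(-1,1)$). *)

theory Defs
  imports "HOL-Analysis.Analysis"
begin

(* The library's analytic_on is complex differentiability near each point and is only
   available for functions complex => complex. The convergent power series is centred at x
   after the substitution y = x + h; has_fps_expansion includes the positivity of the radius
   of convergence. The neighbourhoods are full ones in the reals, so S is meant to be open. *)
definition real_analytic_on :: "(real \<Rightarrow> real) \<Rightarrow> real set \<Rightarrow> bool" where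
  "real_analytic_on f S \<longleftrightarrow>
     (\<forall>x\<in>S. \<exists>F :: real fps. (\<lambda>h. f (x + h)) has_fps_expansion F)"

(* No analyticity is required of the inverse: x |-> x^3 qualifies on {-1<..<1}.
   Values of f outside I are irrelevant when I is open. *)
definition real_analytic_automorphism :: "real set \<Rightarrow> (real \<Rightarrow> real) \<Rightarrow> bool" where
  "real_analytic_automorphism I f \<longleftrightarrow> bij_betw f I I \<and> real_analytic_on f I"

end

theory Submission
  imports Defs
begin

text \<open>
  A polynomial works. The cubic \<open>s x = (3 * x - x ^ 3) / 2\<close> is strictly increasing on
  \<open>{-1..1}\<close>, fixes \<open>-1\<close>, \<open>0\<close> and \<open>1\<close>, and has slope \<open>3 / 2\<close> at \<open>0\<close>; its \<open>n\<close>-fold iterate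
  has the same properties with slope \<open>(3 / 2) ^ n\<close>, which is unbounded in \<open>n\<close>
  (\<open>steep_increasing_poly\<close>). A convex combination of such an iterate with \<open>x ^ 3\<close>, whose slope
  at \<open>0\<close> vanishes, still increases strictly from \<open>-1\<close> to \<open>1\<close> and realises every slope
  in \<open>{0..<(3 / 2) ^ n}\<close> (\<open>increasing_poly_with_slope\<close>). Negative slopes
  follow by changing the sign.
\<close>

lemma real_analytic_on_poly: "real_analytic_on (poly p) S"
  unfolding real_analytic_on_def
proof
  fix x assume "x \<in> S"
  have "eval_fps (fps_of_poly (pcompose p [:x, 1:])) has_fps_expansion
          fps_of_poly (pcompose p [:x, 1:])"
    by (rule eval_fps_has_fps_expansion) simp
  also have "eval_fps (fps_of_poly (pcompose p [:x, 1:])) = (\<lambda>h. poly p (x + h))"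
    by (simp add: fun_eq_iff poly_pcompose)
  finally show "\<exists>F. (\<lambda>h. poly p (x + h)) has_fps_expansion F" ..
qed

lemma bij_betw_open_interval_of_strict_mono_on:
  fixes f :: "real \<Rightarrow> real"
  assumes "a \<le> b" and mono: "strict_mono_on {a..b} f" and cont: "continuous_on {a..b} f"
  shows "bij_betw f {a<..<b} {f a<..<f b}"
proof (rule bij_betw_imageI)
  show "inj_on f {a<..<b}"
    using strict_mono_on_imp_inj_on[OF mono] by (rule inj_on_subset) auto
  show "f ` {a<..<b} = {f a<..<f b}"
  proof (intro equalityI subsetI)
    fix y assume "y \<in> f ` {a<..<b}"
    then show "y \<in> {f a<..<f b}"
      by (auto intro: strict_mono_onD[OF mono])
  next
    fix y assume y: "y \<in> {f a<..<f b}"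
    obtain x where "a \<le> x" "x \<le> b" "f x = y"
      using IVT'[of f a y b] y cont \<open>a \<le> b\<close> by auto
    moreover from this y have "x \<noteq> a" "x \<noteq> b" by auto
    ultimately show "y \<in> f ` {a<..<b}" by force
  qed
qed

lemma strict_mono_on_odd_power:
  assumes "odd n"
  shows "strict_mono_on A (\<lambda>x::real. x ^ n)"
proof (rule strict_mono_onI)
  fix x y :: real
  assume "x < y"
  then have "x ^ n \<le> y ^ n" "x ^ n \<noteq> y ^ n"
    using power_mono_odd[OF assms, of x y] odd_real_root_power_cancel[OF assms, of x]
      odd_real_root_power_cancel[OF assms, of y] by auto
  then show "x ^ n < y ^ n" by simp
qed

lemma strict_mono_on_cubic_step: "strict_mono_on {-1..1} (\<lambda>x::real. (3 * x - x ^ 3) / 2)"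
proof (rule strict_mono_onI)
  fix x y :: real
  assume "x \<in> {-1..1}" "y \<in> {-1..1}" "x < y"
  then have "x\<^sup>2 \<le> 1" "y\<^sup>2 \<le> 1" "0 < (y - x)\<^sup>2"
    by (auto simp: abs_square_le_1 abs_le_iff)
  \<comment> \<open>Since \<open>2 * (x\<^sup>2 + x * y + y\<^sup>2) = 3 * x\<^sup>2 + 3 * y\<^sup>2 - (y - x)\<^sup>2\<close>.\<close>
  then have "x\<^sup>2 + x * y + y\<^sup>2 < 3"
    by (simp add: power2_eq_square algebra_simps)
  then have "0 < (y - x) * (3 - (x\<^sup>2 + x * y + y\<^sup>2))"
    using \<open>x < y\<close> by simp
  also have "\<dots> = (3 * y - y ^ 3) - (3 * x - x ^ 3)"
    by (simp add: power2_eq_square power3_eq_cube algebra_simps)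
  finally show "(3 * x - x ^ 3) / 2 < (3 * y - y ^ 3) / 2"
    by simp
qed

lemma steep_increasing_poly:
  "\<exists>p :: real poly. strict_mono_on {-1..1} (poly p) \<and> poly p (-1) = -1 \<and> poly p 1 = 1 \<and>
     poly p 0 = 0 \<and> poly (pderiv p) 0 = (3 / 2) ^ n"
proof (induction n)
  case 0
  show ?case
    by (rule exI[of _ "[:0, 1:]"]) (simp add: pderiv_pCons strict_mono_on_def)
next
  case (Suc n)
  then obtain p :: "real poly"
    where p: "strict_mono_on {-1..1} (poly p)" "poly p (-1) = -1" "poly p 1 = 1"
      "poly p 0 = 0" "poly (pderiv p) 0 = (3 / 2) ^ n" by blast
  define s :: "real poly" where "s = [:0, 3 / 2, 0, - 1 / 2:]"
  have s: "poly s = (\<lambda>x. (3 * x - x ^ 3) / 2)"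
    by (simp add: s_def fun_eq_iff power3_eq_cube field_simps)
  have s': "poly (pderiv s) 0 = 3 / 2"
    by (simp add: s_def pderiv_pCons)
  have range: "poly p x \<in> {-1..1}" if "x \<in> {-1..1}" for x
    using strict_mono_on_leD[OF p(1), of "-1" x] strict_mono_on_leD[OF p(1), of x 1] p(2,3) that
    by auto
  have "strict_mono_on {-1..1} (poly (pcompose s p))"
  proof (rule strict_mono_onI)
    fix x y :: real
    assume "x \<in> {-1..1}" "y \<in> {-1..1}" "x < y"
    then show "poly (pcompose s p) x < poly (pcompose s p) y"
      using strict_mono_onD[OF strict_mono_on_cubic_step range range]
        strict_mono_onD[OF p(1)] by (simp only: poly_pcompose s)
  qed
  moreover have "poly (pderiv (pcompose s p)) 0 = (3 / 2) ^ Suc n"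
    using p(4,5) s' by (simp add: pderiv_pcompose poly_pcompose)
  moreover have "poly (pcompose s p) (-1) = -1" "poly (pcompose s p) 1 = 1"
    "poly (pcompose s p) 0 = 0"
    using p by (simp_all add: poly_pcompose s)
  ultimately show ?case by blast
qed

lemma increasing_poly_with_slope:
  fixes a :: real
  assumes "0 \<le> a"
  shows "\<exists>p :: real poly. strict_mono_on {-1..1} (poly p) \<and> poly p (-1) = -1 \<and> poly p 1 = 1 \<and>
           poly (pderiv p) 0 = a"
proof -
  obtain n where n: "a < (3 / 2) ^ n"
    using real_arch_pow[of "3 / 2" a] by auto
  obtain q :: "real poly"
    where q: "strict_mono_on {-1..1} (poly q)" "poly q (-1) = -1" "poly q 1 = 1"
      "poly (pderiv q) 0 = (3 / 2) ^ n"
    using steep_increasing_poly by blast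
  define t where "t = a / (3 / 2) ^ n"
  have t: "0 \<le> t" "t < 1" "t * (3 / 2) ^ n = a"
    using assms n by (simp_all add: t_def)
  define p where "p = smult t q + smult (1 - t) (monom 1 3)"
  have p: "poly p x = t * poly q x + (1 - t) * x ^ 3" for x
    by (simp add: p_def poly_monom)
  have "strict_mono_on {-1..1} (poly p)"
  proof (rule strict_mono_onI)
    fix x y :: real
    assume xy: "x \<in> {-1..1}" "y \<in> {-1..1}" "x < y"
    have "t * poly q x \<le> t * poly q y"
      using strict_mono_onD[OF q(1) xy] t(1) by (intro mult_left_mono) auto
    moreover have "(1 - t) * x ^ 3 < (1 - t) * y ^ 3"
      using strict_mono_onD[OF strict_mono_on_odd_power[of 3] xy] t(2) by simp
    ultimately show "poly p x < poly p y"
      by (simp add: p)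
  qed
  moreover have "poly p (-1) = -1" "poly p 1 = 1"
    using q by (simp_all add: p)
  moreover have "poly (pderiv p) 0 = a"
    using q(4) t(3) by (simp add: p_def pderiv_add pderiv_smult pderiv_monom poly_monom)
  ultimately show ?thesis by blast
qed

theorem theorem3p1:
  fixes a :: real
  shows "\<exists>f :: real \<Rightarrow> real.
           real_analytic_automorphism {-1<..<1} f \<and> (f has_real_derivative a) (at 0)"
proof -
  obtain p :: "real poly"
    where p: "strict_mono_on {-1..1} (poly p)" "poly p (-1) = -1" "poly p 1 = 1"
      "poly (pderiv p) 0 = \<bar>a\<bar>"
    using increasing_poly_with_slope[of "\<bar>a\<bar>"] by auto
  have bij: "bij_betw (poly p) {-1<..<1} {-1<..<1}"
    using bij_betw_open_interval_of_strict_mono_on[OF _ p(1)] p(2,3)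
    by (simp add: continuous_on_poly)
  have neg: "bij_betw uminus {-1<..<1} {-1<..<1 :: real}"
    by (rule bij_betwI[where g = uminus]) auto
  have "bij_betw (poly (- p)) {-1<..<1} {-1<..<1}"
    using bij_betw_trans[OF bij neg] by (simp add: o_def flip: poly_minus)
  with bij have "bij_betw (poly (if a < 0 then - p else p)) {-1<..<1} {-1<..<1}"
    by simp
  then have "real_analytic_automorphism {-1<..<1} (poly (if a < 0 then - p else p))"
    by (simp add: real_analytic_automorphism_def real_analytic_on_poly)
  moreover have "poly (pderiv (if a < 0 then - p else p)) 0 = a"
    using p(4) by (simp add: pderiv_minus)
  then have "(poly (if a < 0 then - p else p) has_real_derivative a) (at 0)"
    using poly_DERIV by metis
  ultimately show ?thesis by blast
qed

end
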